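(* Let $(X,d)$ be a compact metric space, let $\mathbb{I}=\{S_1,\dots,S_N\}$ be an iterated function system of similarities on $X$ with similarity dimension $s$, and let $C\subseteq X$ be a non-empty compact set with $\max\{s,\underline{\dim}_{\mathrm B}C\}<\overline{\dim}_{\mathrm B}C$. Let $F_\emptyset$ be the homogeneous attractor of $\mathbb{I}$ and $F_C$ the inhomogeneous attractor of $\mathbb{I}$ with condensation $C$. If $\underline{\dim}_{\mathrm B}C=0$ and $\mathbb{I}$ satisfies the strong open set condition (SOSC), then $$\underline{\dim}_{\mathrm B}F_C=\max\{\underline{\dim}_{\mathrm B}F_\emptyset,\ \underline{\dim}_{\mathrm B}C\}=\underline{\dim}_{\mathrm B}F_\emptyset=s.$$
   Context: An iterated function system (IFS) of similarities on $X$ is a finite collection of maps $S_i:X\to X$ such that for each $i$ there is a constant $\mathrm{Lip}(S_i)\in(0,1)$ with $d(S_i(x),S_i(y))=\mathrm{Lip}(S_i)\,d(x,y)$ for all $x,y\in X$. The homogeneous attractor $F_\emptyset$ is the unique non-empty compact set with $F_\emptyset=\bigcup_{i=1}^N S_i(F_\emptyset)$. The inhomogeneous attractor $F_C$ is the unique non-empty compact set with $F_C=\bigcup_{i=1}^N S_i(F_C)\cup C$. The similarity dimension $s$ is the unique solution of $\sum_{i=1}^N \mathrm{Lip}(S_i)^s=1$. The IFS satisfies the SOSC if there is a non-empty open set $U\subseteq X$ with $F_\emptyset\cap U\neq\emptyset$ and $\bigcup_{i=1}^N S_i(U)\subseteq U$ with the union disjoint. For a non-empty set $E\subseteq X$ and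 $\delta>0$, $N_\delta(E)$ is the minimum number of sets of diameter at most $\delta$ required to cover $E$; $\underline{\dim}_{\mathrm B}E$ and $\overline{\dim}_{\mathrm B}E$ are the $\liminf$ and $\limsup$, respectively, of $\frac{\log N_\delta(E)}{-\log\delta}$ as $\delta\to0$. *)

theory Defs
  imports "HOL-Analysis.Analysis"
begin

section \<open>Box dimensions\<close>

text \<open>The boundedness clause is needed because the library's diameter of an unbounded set is
  unspecified. The definition is only meaningful for totally bounded sets, for which a finite
  cover exists.\<close>

definition covering_number :: "real \<Rightarrow> 'a::metric_space set \<Rightarrow> nat" where
  "covering_number \<delta> E =
     (LEAST n. \<exists>\<U>. finite \<U> \<and> card \<U> = n \<and> E \<subseteq> \<Union>\<U> \<and> (\<forall>U\<in>\<U>. bounded U \<and> diameter U \<le> \<delta>))"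

text \<open>Dimensions are extended reals: the box dimension of a compact set may be infinite.\<close>

definition lower_box_dim :: "'a::metric_space set \<Rightarrow> ereal" where
  "lower_box_dim E = Liminf (at_right 0) (\<lambda>\<delta>. ereal (ln (real (covering_number \<delta> E)) / - ln \<delta>))"

definition upper_box_dim :: "'a::metric_space set \<Rightarrow> ereal" where
  "upper_box_dim E = Limsup (at_right 0) (\<lambda>\<delta>. ereal (ln (real (covering_number \<delta> E)) / - ln \<delta>))"


section \<open>Iterated function systems of similarities\<close>

text \<open>The ratio \<open>r i\<close> plays the role of $\mathrm{Lip}(S_i)$. It is kept as data because it is not
  determined by \<open>S i\<close> when \<open>X\<close> has a single point.\<close>

definition similarity_ifs ::
    "'a::metric_space set \<Rightarrow> nat \<Rightarrow> (nat \<Rightarrow> 'a \<Rightarrow> 'a) \<Rightarrow> (nat \<Rightarrow> real) \<Rightarrow> bool" where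
  "similarity_ifs X N S r \<longleftrightarrow>
     1 \<le> N \<and>
     (\<forall>i\<in>{1..N}. S i ` X \<subseteq> X \<and> 0 < r i \<and> r i < 1 \<and>
        (\<forall>x\<in>X. \<forall>y\<in>X. dist (S i x) (S i y) = r i * dist x y))"

definition similarity_dim :: "nat \<Rightarrow> (nat \<Rightarrow> real) \<Rightarrow> real" where
  "similarity_dim N r = (THE s. (\<Sum>i=1..N. r i powr s) = 1)"

definition homogeneous_attractor ::
    "'a::metric_space set \<Rightarrow> nat \<Rightarrow> (nat \<Rightarrow> 'a \<Rightarrow> 'a) \<Rightarrow> 'a set" where
  "homogeneous_attractor X N S =
     (THE F. F \<subseteq> X \<and> F \<noteq> {} \<and> compact F \<and> F = (\<Union>i\<in>{1..N}. S i ` F))"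

definition inhomogeneous_attractor ::
    "'a::metric_space set \<Rightarrow> nat \<Rightarrow> (nat \<Rightarrow> 'a \<Rightarrow> 'a) \<Rightarrow> 'a set \<Rightarrow> 'a set" where
  "inhomogeneous_attractor X N S C =
     (THE F. F \<subseteq> X \<and> F \<noteq> {} \<and> compact F \<and> F = (\<Union>i\<in>{1..N}. S i ` F) \<union> C)"

definition strong_open_set_condition ::
    "'a::metric_space set \<Rightarrow> nat \<Rightarrow> (nat \<Rightarrow> 'a \<Rightarrow> 'a) \<Rightarrow> bool" where
  "strong_open_set_condition X N S \<longleftrightarrow>
     (\<exists>U. openin (top_of_set X) U \<and> U \<noteq> {} \<and>
          homogeneous_attractor X N S \<inter> U \<noteq> {} \<and>
          (\<Union>i\<in>{1..N}. S i ` U) \<subseteq> U \<and>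
          disjoint_family_on (\<lambda>i. S i ` U) {1..N})"


section \<open>The definite descriptions above are well defined\<close>

lemma similarity_dim_ex1:
  fixes r :: "nat \<Rightarrow> real"
  assumes "1 \<le> N" and r: "\<And>i. i \<in> {1..N} \<Longrightarrow> 0 < r i \<and> r i < 1"
  shows "\<exists>!s. (\<Sum>i=1..N. r i powr s) = 1"
proof -
  let ?f = "\<lambda>s::real. \<Sum>i=1..N. r i powr s"
  have dec: "?f t < ?f s" if "s < t" for s t
    using that r assms(1) by (intro sum_strict_mono) (auto intro!: powr_less_mono')
  have "(?f \<longlongrightarrow> (\<Sum>i=1..N. 0)) at_top"
  proof (intro tendsto_sum)
    fix i assume i: "i \<in> {1..N}"
    have "filterlim (\<lambda>s. ln (r i) * s) at_bot at_top"
      using r[OF i] by (intro filterlim_tendsto_neg_mult_at_bot[where c = "ln (r i)"] filterlim_ident) auto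
    then have "((\<lambda>s. exp (ln (r i) * s)) \<longlongrightarrow> 0) at_top"
      by (rule filterlim_compose[OF exp_at_bot])
    then show "((\<lambda>s. r i powr s) \<longlongrightarrow> 0) at_top"
      using r[OF i] by (simp add: powr_def mult.commute)
  qed
  then have "eventually (\<lambda>s. ?f s < 1) at_top"
    by (intro order_tendstoD) auto
  then obtain b where b: "\<And>s. b \<le> s \<Longrightarrow> ?f s < 1"
    unfolding eventually_at_top_linorder by blast
  have f0: "?f 0 = real N"
  proof -
    have "r i powr 0 = 1" if "i \<in> {1..N}" for i using r[OF that] by simp
    then show ?thesis by simp
  qed
  have "\<exists>s\<ge>0. s \<le> max b 0 \<and> ?f s = 1"
  proof (rule IVT2')
    show "?f (max b 0) \<le> 1" "1 \<le> ?f 0" "0 \<le> max b 0"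
      using b[of "max b 0"] f0 assms(1) by auto
    show "continuous_on {0..max b 0} ?f"
    proof (intro continuous_intros ballI)
      fix i assume "i \<in> {1..N}"
      then show "r i \<noteq> 0" using r[of i] by simp
    qed
  qed
  then obtain s where "?f s = 1"
    by blast
  then show ?thesis
  proof (rule ex1I)
    fix t assume "?f t = 1"
    then show "t = s"
      using dec[of s t] dec[of t s] \<open>?f s = 1\<close> by (cases s t rule: linorder_cases) simp_all
  qed
qed

lemma attractor_subset:
  assumes ifs: "similarity_ifs X N S r"
    and F: "F \<subseteq> X" "compact F" "F = (\<Union>i\<in>{1..N}. S i ` F) \<union> C"
    and G: "G \<subseteq> X" "G \<noteq> {}" "compact G" "G = (\<Union>i\<in>{1..N}. S i ` G) \<union> C"
  shows "F \<subseteq> G"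
proof (cases "F = {}")
  case False
  obtain x where x: "x \<in> F" "\<And>y. y \<in> F \<Longrightarrow> infdist y G \<le> infdist x G"
    using continuous_attains_sup[OF F(2) False, of "\<lambda>x. infdist x G"]
      continuous_on_infdist[OF continuous_on_id] by blast
  have "infdist x G = 0"
  proof (cases "x \<in> C")
    case True
    then have "x \<in> G" using G(4) by blast
    then show ?thesis by simp
  next
    case False
    then obtain i y where iy: "i \<in> {1..N}" "y \<in> F" "x = S i y"
      using x(1) F(3) by blast
    obtain z where z: "z \<in> G" "\<And>w. w \<in> G \<Longrightarrow> dist y z \<le> dist y w"
      using continuous_attains_inf[OF G(3,2), of "\<lambda>w. dist y w"]
        continuous_on_dist[OF continuous_on_const continuous_on_id] by blast
    have dz: "dist y z \<le> infdist y G"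
      unfolding infdist_def using G(2) z(2) by (auto intro: cINF_greatest)
    have ri: "0 < r i" "r i < 1" "dist (S i y) (S i z) = r i * dist y z"
    proof -
      have "y \<in> X" "z \<in> X" using iy(2) z(1) F(1) G(1) by blast+
      then show "0 < r i" "r i < 1" "dist (S i y) (S i z) = r i * dist y z"
        using ifs iy(1) unfolding similarity_ifs_def by simp_all
    qed
    have "S i z \<in> G" using G(4) iy(1) z(1) by blast
    then have "infdist x G \<le> r i * dist y z"
      using infdist_le[of "S i z" G x] iy(3) ri(3) by simp
    also have "\<dots> \<le> r i * infdist x G"
      using dz x(2)[OF iy(2)] ri(1) by (intro mult_left_mono) auto
    finally have "(1 - r i) * infdist x G \<le> 0" by (simp add: algebra_simps)
    then show ?thesis
      using ri(2) infdist_nonneg[of x G] by (simp add: mult_le_0_iff)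
  qed
  then have "infdist y G = 0" if "y \<in> F" for y
    using x(2)[OF that] infdist_nonneg[of y G] by simp
  then show ?thesis
    using in_closed_iff_infdist_zero[OF compact_imp_closed[OF G(3)] G(2)] by blast
qed simp

lemma attractor_ex1:
  assumes X: "compact X" "X \<noteq> {}" and ifs: "similarity_ifs X N S r"
    and C: "compact C" "C \<subseteq> X"
  shows "\<exists>!F. F \<subseteq> X \<and> F \<noteq> {} \<and> compact F \<and> F = (\<Union>i\<in>{1..N}. S i ` F) \<union> C"
proof (rule ex_ex1I)
  define T where "T A = (\<Union>i\<in>{1..N}. S i ` A) \<union> C" for A
  define K where "K n = (T ^^ n) X" for n
  define F where "F = (\<Inter>n. K n)"
  have sim: "S i ` X \<subseteq> X" "0 < r i" "r i < 1"
    "\<And>x y. x \<in> X \<Longrightarrow> y \<in> X \<Longrightarrow> dist (S i x) (S i y) = r i * dist x y" if "i \<in> {1..N}" for i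
    using ifs that unfolding similarity_ifs_def by auto
  have N: "1 \<in> {1..N}" using ifs by (auto simp: similarity_ifs_def)
  have mono: "T A \<subseteq> T B" if "A \<subseteq> B" for A B using that unfolding T_def by blast
  have TX: "T X \<subseteq> X" unfolding T_def using sim(1) C(2) by blast
  have K0: "K 0 = X" and KS: "K (Suc n) = T (K n)" for n by (simp_all add: K_def)
  have step: "K (Suc n) \<subseteq> K n" for n
    by (induction n) (use TX mono in \<open>auto simp: K0 KS\<close>)
  have anti: "K n \<subseteq> K m" if "m \<le> n" for m n
    using lift_Suc_antimono_le[of K, OF step that] by simp
  have KX: "K n \<subseteq> X" for n using anti[of 0 n] K0 by simp
  have cont: "continuous_on X (S i)" if "i \<in> {1..N}" for i
  proof -
    have "(r i)-lipschitz_on X (S i)"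
      using sim[OF that] by (intro lipschitz_onI) auto
    then show ?thesis by (rule lipschitz_on_continuous_on)
  qed
  have compK: "compact (K n)" for n
  proof (induction n)
    case (Suc n)
    have "compact (S i ` K n)" if "i \<in> {1..N}" for i
      using compact_continuous_image[OF continuous_on_subset[OF cont[OF that] KX] Suc] .
    then show ?case unfolding KS T_def
      by (intro compact_Un compact_UN C(1)) auto
  qed (simp add: K0 X)
  have neK: "K n \<noteq> {}" for n
  proof (induction n)
    case (Suc n)
    then show ?case unfolding KS T_def using N by blast
  qed (simp add: K0 X)
  show "\<exists>F. F \<subseteq> X \<and> F \<noteq> {} \<and> compact F \<and> F = (\<Union>i\<in>{1..N}. S i ` F) \<union> C"
  proof (intro exI[of _ F] conjI)
    show "F \<subseteq> X" using KX unfolding F_def by blast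
    have "closed F" unfolding F_def
      using compact_imp_closed[OF compK] by (intro closed_INT ballI)
    moreover have "X \<inter> F = F" using KX unfolding F_def by blast
    ultimately show "compact F" using compact_Int_closed[OF X(1), of F] by simp
    have "K 0 \<inter> (\<Inter>n\<in>UNIV. K n) \<noteq> {}"
    proof (rule compact_imp_fip_image[OF compK])
      show "closed (K i)" for i using compK compact_imp_closed by blast
    next
      fix I :: "nat set" assume I: "finite I" "I \<subseteq> UNIV"
      have "K (Max (insert 0 I)) \<subseteq> K 0 \<inter> (\<Inter>n\<in>I. K n)"
        using I(1) by (intro Int_greatest INT_greatest anti) auto
      then show "K 0 \<inter> (\<Inter>n\<in>I. K n) \<noteq> {}" using neK by blast
    qed
    then show "F \<noteq> {}" unfolding F_def by blast
    have "T F \<subseteq> K n" for n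
    proof -
      have "T F \<subseteq> T (K n)" by (rule mono) (auto simp: F_def)
      then show ?thesis using step[of n] KS by blast
    qed
    then have "T F \<subseteq> F" unfolding F_def by blast
    moreover have "F \<subseteq> T F"
    proof
      fix x assume x: "x \<in> F"
      show "x \<in> T F"
      proof (cases "x \<in> C")
        case False
        have "\<exists>i\<in>{1..N}. \<forall>n. x \<in> S i ` K n"
        proof (rule ccontr)
          assume "\<not> ?thesis"
          then obtain m where m: "\<And>i. i \<in> {1..N} \<Longrightarrow> x \<notin> S i ` K (m i)" by metis
          define n where "n = Max (m ` {1..N})"
          have "x \<in> T (K n)" using x KS unfolding F_def by blast
          then obtain i where i: "i \<in> {1..N}" "x \<in> S i ` K n"
            using False unfolding T_def by blast
          have "m i \<le> n" using i(1) unfolding n_def by (intro Max_ge) auto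
          then show False using anti[of "m i" n] m[OF i(1)] i(2) by blast
        qed
        then obtain i where i: "i \<in> {1..N}" "\<And>n. x \<in> S i ` K n" by blast
        obtain y where y: "y \<in> X" "x = S i y" using i(2)[of 0] K0 by blast
        have "y \<in> K n" for n
        proof -
          obtain z where z: "z \<in> K n" "x = S i z" using i(2) by blast
          then have "z \<in> X" using KX by blast
          then have "r i * dist y z = 0" using sim(4)[OF i(1) y(1), of z] y(2) z(2) by simp
          then have "y = z" using sim(2)[OF i(1)] by simp
          then show ?thesis using z by simp
        qed
        then show ?thesis using i(1) y(2) unfolding T_def F_def by blast
      qed (simp add: T_def)
    qed
    ultimately show "F = (\<Union>i\<in>{1..N}. S i ` F) \<union> C" unfolding T_def by blast
  qed
next
  fix F G
  assume "F \<subseteq> X \<and> F \<noteq> {} \<and> compact F \<and> F = (\<Union>i\<in>{1..N}. S i ` F) \<union> C"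
    and "G \<subseteq> X \<and> G \<noteq> {} \<and> compact G \<and> G = (\<Union>i\<in>{1..N}. S i ` G) \<union> C"
  then show "F = G"
    using attractor_subset[OF ifs, of F C G] attractor_subset[OF ifs, of G C F] by blast
qed

lemma homogeneous_attractor_eq: "homogeneous_attractor X N S = inhomogeneous_attractor X N S {}"
  by (simp add: homogeneous_attractor_def inhomogeneous_attractor_def)

end

theory Submission
  imports Defs
begin

text \<open>
  Let \<open>F\<close> be the homogeneous attractor, \<open>G\<close> the inhomogeneous one and \<open>s\<close> the similarity dimension.
  Since \<open>F \<subseteq> G\<close>, it is enough to show that \<open>s\<close> is at most the lower dimension of \<open>F\<close> and that the
  lower dimension of \<open>G\<close> is at most \<open>s\<close>. Both bounds come from a recursion that relates covering
  numbers at the scale \<open>\<delta>\<close> to covering numbers at larger scales, and both are solved by induction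
  from large scales to small ones (\<open>scale_induct\<close>).

  For the upper bound (\<open>lower_box_dim_inhomogeneous_le\<close>) let $t > s$, so that
  $\<Sum>_i r_i^t < 1$. Covering \<open>G\<close> by covers of its pieces $S_i(G)$ and of \<open>C\<close> bounds its covering
  number at the scale \<open>\<delta>\<close> by the covering number of \<open>C\<close> at the same scale times a constant
  multiple of $\<delta>^{-t}$. The covering number of \<open>C\<close> at the larger scales $\<delta> / r_i$
  is not a problem, as it is smaller. Hence only a single scale of \<open>C\<close> matters, and for suitable
  arbitrarily small scales the covering number of \<open>C\<close> is at most $\<delta>^{-\<epsilon>}$ because the lower
  dimension of \<open>C\<close> is \<open>0\<close>.

  For the lower bound (\<open>lower_box_dim_ge_strong_open_set\<close>) let \<open>0 \<le> t < s\<close>. The strong open set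
  condition yields finitely many disjoint scaled copies of \<open>F\<close> inside \<open>F\<close> such that the \<open>t\<close>-th powers
  of the ratios add up to at least \<open>1\<close>. Being compact, these copies have positive distance from each
  other, which makes the covering number of \<open>F\<close> superadditive at small scales
  (\<open>lower_box_dim_ge_disjoint_copies\<close>).
\<close>

section \<open>Covers and covering numbers\<close>

text \<open>A bound on pairwise distances is equivalent to boundedness together with a bound on the
  diameter, as soon as the mesh \<open>\<delta>\<close> is nonnegative. It passes to subsets and to images without a case
  distinction for the empty set.\<close>

definition fine_cover :: "real \<Rightarrow> 'a::metric_space set \<Rightarrow> 'a set set \<Rightarrow> bool" where
  "fine_cover \<delta> E \<U> \<longleftrightarrow>
     finite \<U> \<and> E \<subseteq> \<Union>\<U> \<and> (\<forall>A\<in>\<U>. \<forall>x\<in>A. \<forall>y\<in>A. dist x y \<le> \<delta>)"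

lemma bounded_diameter_le_iff:
  fixes A :: "'a::metric_space set"
  assumes "0 \<le> \<delta>"
  shows "bounded A \<and> diameter A \<le> \<delta> \<longleftrightarrow> (\<forall>x\<in>A. \<forall>y\<in>A. dist x y \<le> \<delta>)"
proof
  assume "bounded A \<and> diameter A \<le> \<delta>"
  then show "\<forall>x\<in>A. \<forall>y\<in>A. dist x y \<le> \<delta>"
    using diameter_bounded_bound order_trans by blast
next
  assume *: "\<forall>x\<in>A. \<forall>y\<in>A. dist x y \<le> \<delta>"
  then have "bounded A" unfolding bounded_two_points by blast
  moreover have "diameter A \<le> \<delta>"
    using * assms unfolding diameter_def by (auto intro: cSUP_least)
  ultimately show "bounded A \<and> diameter A \<le> \<delta>" by simp
qed

lemma covering_number_eq_Least:
  assumes "0 \<le> \<delta>"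
  shows "covering_number \<delta> E = (LEAST n. \<exists>\<U>. fine_cover \<delta> E \<U> \<and> card \<U> = n)"
proof -
  have "(finite \<U> \<and> card \<U> = n \<and> E \<subseteq> \<Union>\<U> \<and> (\<forall>U\<in>\<U>. bounded U \<and> diameter U \<le> \<delta>))
      \<longleftrightarrow> (fine_cover \<delta> E \<U> \<and> card \<U> = n)" for \<U> n
    unfolding fine_cover_def bounded_diameter_le_iff[OF assms] by auto
  then show ?thesis unfolding covering_number_def by simp
qed

lemma covering_number_le_card:
  assumes "0 \<le> \<delta>" "fine_cover \<delta> E \<U>"
  shows "covering_number \<delta> E \<le> card \<U>"
  unfolding covering_number_eq_Least[OF assms(1)] using assms(2) by (intro Least_le) blast

lemma minimal_fine_cover:
  fixes E :: "'a::metric_space set"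
  assumes "compact E" "0 < \<delta>"
  obtains \<U> where "fine_cover \<delta> E \<U>" "card \<U> = covering_number \<delta> E"
proof -
  obtain k where k: "finite k" "E \<subseteq> (\<Union>x\<in>k. ball x (\<delta>/2))"
    using seq_compact_imp_totally_bounded[OF compact_imp_seq_compact[OF assms(1)]] assms(2)
    by (metis half_gt_zero)
  have "dist y z \<le> \<delta>" if "y \<in> ball x (\<delta>/2)" "z \<in> ball x (\<delta>/2)" for x y z :: 'a
    using that dist_triangle_half_r[of x y \<delta> z] by (auto simp: less_imp_le)
  then have "fine_cover \<delta> E ((\<lambda>x. ball x (\<delta>/2)) ` k)"
    using k unfolding fine_cover_def by blast
  then have "\<exists>n \<U>. fine_cover \<delta> E \<U> \<and> card \<U> = n" by blast
  from LeastI_ex[OF this] show ?thesis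
    using that covering_number_eq_Least[of \<delta> E] assms(2) by auto
qed

lemma covering_number_pos:
  assumes "compact E" "E \<noteq> {}" "0 < \<delta>"
  shows "1 \<le> covering_number \<delta> E"
proof -
  obtain \<U> where \<U>: "fine_cover \<delta> E \<U>" "card \<U> = covering_number \<delta> E"
    by (rule minimal_fine_cover[OF assms(1,3)])
  then have "card \<U> \<noteq> 0" using assms(2) unfolding fine_cover_def by auto
  then show ?thesis using \<U>(2) by simp
qed

lemma covering_number_le_1:
  assumes "bounded E" "diameter E \<le> \<delta>"
  shows "covering_number \<delta> E \<le> 1"
proof -
  have "0 \<le> \<delta>" using diameter_ge_0[OF assms(1)] assms(2) by simp
  moreover from this have "fine_cover \<delta> E {E}"
    using assms bounded_diameter_le_iff[of \<delta> E] unfolding fine_cover_def by simp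
  ultimately show ?thesis using covering_number_le_card by fastforce
qed

lemma covering_number_mono:
  assumes "compact F" "E \<subseteq> F" "0 < \<epsilon>" "\<epsilon> \<le> \<delta>"
  shows "covering_number \<delta> E \<le> covering_number \<epsilon> F"
proof -
  obtain \<U> where \<U>: "fine_cover \<epsilon> F \<U>" "card \<U> = covering_number \<epsilon> F"
    by (rule minimal_fine_cover[OF assms(1,3)])
  have "fine_cover \<delta> E \<U>" using \<U>(1) assms(2,4) unfolding fine_cover_def
    by (meson order_trans)
  then show ?thesis using covering_number_le_card[of \<delta> E \<U>] \<U>(2) assms(3,4) by simp
qed

lemma covering_number_Un:
  assumes "compact E" "compact F" "0 < \<delta>"
  shows "covering_number \<delta> (E \<union> F) \<le> covering_number \<delta> E + covering_number \<delta> F"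
proof -
  obtain \<U> where \<U>: "fine_cover \<delta> E \<U>" "card \<U> = covering_number \<delta> E"
    by (rule minimal_fine_cover[OF assms(1,3)])
  obtain \<V> where \<V>: "fine_cover \<delta> F \<V>" "card \<V> = covering_number \<delta> F"
    by (rule minimal_fine_cover[OF assms(2,3)])
  have "fine_cover \<delta> (E \<union> F) (\<U> \<union> \<V>)" using \<U>(1) \<V>(1)
    unfolding fine_cover_def by (simp add: ball_Un subset_iff)
  then have "covering_number \<delta> (E \<union> F) \<le> card (\<U> \<union> \<V>)"
    by (rule covering_number_le_card[OF less_imp_le[OF assms(3)]])
  also have "\<dots> \<le> card \<U> + card \<V>" by (rule card_Un_le)
  finally show ?thesis using \<U>(2) \<V>(2) by simp
qed

lemma covering_number_UN:
  assumes "finite I" "\<And>i. i \<in> I \<Longrightarrow> compact (E i)" "0 < \<delta>"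
  shows "covering_number \<delta> (\<Union>i\<in>I. E i) \<le> (\<Sum>i\<in>I. covering_number \<delta> (E i))"
  using assms(1,2)
proof (induction I rule: finite_induct)
  case empty
  have "fine_cover \<delta> {} {}" by (simp add: fine_cover_def)
  then show ?case using covering_number_le_card[of \<delta> "{}" "{}"] assms(3) by simp
next
  case (insert i I)
  have "compact (\<Union>i\<in>I. E i)" using insert by (intro compact_UN) auto
  then have "covering_number \<delta> (E i \<union> (\<Union>i\<in>I. E i))
      \<le> covering_number \<delta> (E i) + covering_number \<delta> (\<Union>i\<in>I. E i)"
    using insert.prems assms(3) by (intro covering_number_Un) auto
  also have "\<dots> \<le> covering_number \<delta> (E i) + (\<Sum>i\<in>I. covering_number \<delta> (E i))"
    using insert by simp
  finally show ?case using insert.hyps by simp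
qed

lemma covering_number_image_le:
  assumes "compact E" "0 < \<delta>" "0 < \<rho>"
    and f: "\<And>x y. x \<in> E \<Longrightarrow> y \<in> E \<Longrightarrow> dist (f x) (f y) \<le> \<rho> * dist x y"
  shows "covering_number \<delta> (f ` E) \<le> covering_number (\<delta> / \<rho>) E"
proof -
  obtain \<U> where \<U>: "fine_cover (\<delta> / \<rho>) E \<U>" "card \<U> = covering_number (\<delta> / \<rho>) E"
    by (rule minimal_fine_cover[OF assms(1) divide_pos_pos[OF assms(2,3)]])
  have small: "dist u v \<le> \<delta>" if "A \<in> \<U>" "u \<in> f ` (A \<inter> E)" "v \<in> f ` (A \<inter> E)" for A u v
  proof -
    obtain x y where xy: "x \<in> A" "x \<in> E" "u = f x" "y \<in> A" "y \<in> E" "v = f y"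
      using \<open>u \<in> f ` (A \<inter> E)\<close> \<open>v \<in> f ` (A \<inter> E)\<close> by (elim imageE IntE) simp
    have "dist x y \<le> \<delta> / \<rho>" using \<U>(1) \<open>A \<in> \<U>\<close> xy unfolding fine_cover_def by simp
    then have "\<rho> * dist x y \<le> \<delta>" using assms(3) by (simp add: field_simps)
    then show ?thesis using f[OF xy(2,5)] xy(3,6) by simp
  qed
  have "E \<subseteq> \<Union>\<U>" using \<U>(1) by (simp add: fine_cover_def)
  then have "f ` E \<subseteq> (\<Union>A\<in>\<U>. f ` (A \<inter> E))" by blast
  then have "fine_cover \<delta> (f ` E) ((\<lambda>A. f ` (A \<inter> E)) ` \<U>)"
    using \<U>(1) small unfolding fine_cover_def by (simp del: image_Int)
  then have "covering_number \<delta> (f ` E) \<le> card ((\<lambda>A. f ` (A \<inter> E)) ` \<U>)"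
    by (rule covering_number_le_card[OF less_imp_le[OF assms(2)]])
  also have "\<dots> \<le> card \<U>"
    using \<U>(1) unfolding fine_cover_def by (intro card_image_le) simp
  finally show ?thesis using \<U>(2) by simp
qed

text \<open>The lower bound on distances makes \<open>f\<close> invertible with inverse of Lipschitz constant \<open>1 / \<rho>\<close>, so a
  cover of the image pulls back to a cover of \<open>E\<close>.\<close>

lemma covering_number_image_ge:
  assumes "compact (f ` E)" "0 < \<delta>" "0 < \<rho>"
    and f: "\<And>x y. x \<in> E \<Longrightarrow> y \<in> E \<Longrightarrow> \<rho> * dist x y \<le> dist (f x) (f y)"
  shows "covering_number (\<delta> / \<rho>) E \<le> covering_number \<delta> (f ` E)"
proof -
  have inj: "inj_on f E"
  proof (rule inj_onI)
    fix x y assume "x \<in> E" "y \<in> E" "f x = f y"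
    then have "\<rho> * dist x y \<le> 0" using f[of x y] by simp
    then show "x = y" using assms(3) by (simp add: mult_le_0_iff)
  qed
  have "dist (the_inv_into E f x) (the_inv_into E f y) \<le> (1 / \<rho>) * dist x y"
    if xy: "x \<in> f ` E" "y \<in> f ` E" for x y
  proof -
    obtain x' y' where "x' \<in> E" "y' \<in> E" "x = f x'" "y = f y'" using xy by blast
    then show ?thesis using f[of x' y'] inj assms(3)
      by (simp add: the_inv_into_f_f field_simps)
  qed
  then have "covering_number (\<delta> / \<rho>) (the_inv_into E f ` f ` E)
      \<le> covering_number (\<delta> / \<rho> / (1 / \<rho>)) (f ` E)"
    using assms(1-3) by (intro covering_number_image_le) simp_all
  then show ?thesis
    using assms(3) inj by (simp add: the_inv_into_onto)
qed

text \<open>A covering set of diameter at most \<open>\<delta> < d\<close> cannot meet two of the pieces \<open>K j\<close>. A cover of \<open>E\<close>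
  therefore splits into disjoint subfamilies that cover the individual pieces.\<close>

lemma covering_number_separated:
  assumes "compact E" "finite J" "0 < \<delta>" "\<delta> < d"
    and sub: "\<And>j. j \<in> J \<Longrightarrow> K j \<subseteq> E"
    and sep: "\<And>i j x y. \<lbrakk>i \<in> J; j \<in> J; i \<noteq> j; x \<in> K i; y \<in> K j\<rbrakk> \<Longrightarrow> d \<le> dist x y"
  shows "(\<Sum>j\<in>J. covering_number \<delta> (K j)) \<le> covering_number \<delta> E"
proof -
  obtain \<U> where \<U>: "fine_cover \<delta> E \<U>" "card \<U> = covering_number \<delta> E"
    by (rule minimal_fine_cover[OF assms(1,3)])
  define V where "V j = {A\<in>\<U>. A \<inter> K j \<noteq> {}}" for j
  have fin: "finite \<U>" using \<U>(1) by (simp add: fine_cover_def)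
  have "covering_number \<delta> (K j) \<le> card (V j)" if "j \<in> J" for j
  proof (rule covering_number_le_card)
    show "fine_cover \<delta> (K j) (V j)"
      unfolding fine_cover_def
    proof (intro conjI)
      show "finite (V j)" using fin by (simp add: V_def)
      show "K j \<subseteq> \<Union>(V j)"
      proof
        fix x assume "x \<in> K j"
        moreover from this obtain A where "A \<in> \<U>" "x \<in> A"
          using \<U>(1) sub[OF \<open>j \<in> J\<close>] unfolding fine_cover_def by blast
        ultimately show "x \<in> \<Union>(V j)" unfolding V_def by blast
      qed
      show "\<forall>A\<in>V j. \<forall>x\<in>A. \<forall>y\<in>A. dist x y \<le> \<delta>"
        using \<U>(1) unfolding fine_cover_def V_def by blast
    qed
  qed (use assms(3) in simp)
  then have "(\<Sum>j\<in>J. covering_number \<delta> (K j)) \<le> (\<Sum>j\<in>J. card (V j))"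
    by (rule sum_mono)
  also have "\<dots> = card (\<Union>j\<in>J. V j)"
  proof (rule card_UN_disjoint[symmetric])
    show "\<forall>i\<in>J. \<forall>j\<in>J. i \<noteq> j \<longrightarrow> V i \<inter> V j = {}"
    proof (intro ballI impI)
      fix i j assume ij: "i \<in> J" "j \<in> J" "i \<noteq> j"
      have False if "A \<in> V i" "A \<in> V j" for A
      proof -
        obtain x y where xy: "x \<in> A" "x \<in> K i" "y \<in> A" "y \<in> K j"
          using \<open>A \<in> V i\<close> \<open>A \<in> V j\<close> unfolding V_def by blast
        have "dist x y \<le> \<delta>" using \<U>(1) xy(1,3) \<open>A \<in> V i\<close>
          unfolding fine_cover_def V_def by blast
        then show False using sep[of i j x y] ij xy assms(4) by simp
      qed
      then show "V i \<inter> V j = {}" by blast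
    qed
  qed (use fin assms(2) in \<open>auto simp: V_def\<close>)
  also have "\<dots> \<le> card \<U>"
    using fin by (intro card_mono) (auto simp: V_def)
  finally show ?thesis using \<U>(2) by simp
qed


section \<open>Lower box dimension from power bounds\<close>

lemma eventually_small: "eventually (\<lambda>\<delta>::real. 0 < \<delta> \<and> ln \<delta> < b) (at_right 0)"
  using filterlim_at_bot_dense[of ln "at_right (0::real)"] ln_at_0
  by (auto simp: eventually_at_filter elim: eventually_mono intro!: eventually_conj)

lemma lower_box_dim_nonneg:
  assumes "compact E" "E \<noteq> {}"
  shows "0 \<le> lower_box_dim E"
  unfolding lower_box_dim_def
proof (rule Liminf_bounded)
  show "\<forall>\<^sub>F \<delta> in at_right 0. 0 \<le> ereal (ln (real (covering_number \<delta> E)) / - ln \<delta>)"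
    using eventually_small[of 0]
  proof (rule eventually_mono)
    fix \<delta> :: real assume \<delta>: "0 < \<delta> \<and> ln \<delta> < 0"
    then have "1 \<le> covering_number \<delta> E" using covering_number_pos assms by blast
    then have "0 \<le> ln (real (covering_number \<delta> E))" by simp
    then show "0 \<le> ereal (ln (real (covering_number \<delta> E)) / - ln \<delta>)"
      using \<delta> by (simp add: divide_nonneg_neg)
  qed
qed

lemma lower_box_dim_mono:
  assumes "E \<subseteq> F" "E \<noteq> {}" "compact E" "compact F"
  shows "lower_box_dim E \<le> lower_box_dim F"
  unfolding lower_box_dim_def
proof (rule Liminf_mono)
  show "\<forall>\<^sub>F \<delta> in at_right 0. ereal (ln (real (covering_number \<delta> E)) / - ln \<delta>)
      \<le> ereal (ln (real (covering_number \<delta> F)) / - ln \<delta>)"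
    using eventually_small[of 0]
  proof (rule eventually_mono)
    fix \<delta> :: real assume \<delta>: "0 < \<delta> \<and> ln \<delta> < 0"
    have "1 \<le> covering_number \<delta> E" "covering_number \<delta> E \<le> covering_number \<delta> F"
      using covering_number_pos[OF assms(3,2)] covering_number_mono[OF assms(4,1)] \<delta> by auto
    then have "ln (real (covering_number \<delta> E)) \<le> ln (real (covering_number \<delta> F))" by simp
    then have "ln (real (covering_number \<delta> E)) / - ln \<delta> \<le> ln (real (covering_number \<delta> F)) / - ln \<delta>"
      using \<delta> by (intro divide_right_mono) auto
    then show "ereal (ln (real (covering_number \<delta> E)) / - ln \<delta>)
      \<le> ereal (ln (real (covering_number \<delta> F)) / - ln \<delta>)" by simp
  qed
qed

lemma lower_box_dim_geI:
  assumes "0 < c" and c: "\<And>\<delta>. 0 < \<delta> \<Longrightarrow> c * \<delta> powr (-t) \<le> real (covering_number \<delta> E)"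
  shows "ereal t \<le> lower_box_dim E"
  unfolding lower_box_dim_def le_Liminf_iff
proof (intro allI impI)
  fix y assume "y < ereal t"
  then obtain u where u: "y < ereal u" "u < t"
    using ereal_dense2[of y "ereal t"] by auto
  show "\<forall>\<^sub>F \<delta> in at_right 0. y < ereal (ln (real (covering_number \<delta> E)) / - ln \<delta>)"
    using eventually_small[of "min 0 (ln c / (t - u))"]
  proof (rule eventually_mono)
    fix \<delta> :: real assume \<delta>: "0 < \<delta> \<and> ln \<delta> < min 0 (ln c / (t - u))"
    have "(t - u) * ln \<delta> < ln c" using \<delta> u by (simp add: field_simps)
    then have "u * - ln \<delta> < ln c + - t * ln \<delta>" by (simp add: algebra_simps)
    also have "\<dots> = ln (c * \<delta> powr (-t))"
      using assms(1) \<delta> by (simp add: ln_mult ln_powr)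
    also have "\<dots> \<le> ln (real (covering_number \<delta> E))"
      using c[of \<delta>] assms(1) \<delta> by (intro ln_mono) auto
    finally have "u < ln (real (covering_number \<delta> E)) / - ln \<delta>"
      using \<delta> by (simp add: field_simps)
    then show "y < ereal (ln (real (covering_number \<delta> E)) / - ln \<delta>)"
      using u(1) by (meson ereal_less_eq(3) less_imp_le order_less_le_trans)
  qed
qed

text \<open>A limit inferior is bounded above by a bound along any sequence of scales that tends to \<open>0\<close>, so
  the estimate is needed only frequently. This is how information about the lower dimension of a set
  is passed on.\<close>

lemma lower_box_dim_leI:
  assumes "compact E" "E \<noteq> {}"
    and freq: "frequently (\<lambda>\<delta>. real (covering_number \<delta> E) \<le> c * \<delta> powr (-t)) (at_right 0)"
  shows "lower_box_dim E \<le> ereal t"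
proof (rule ccontr)
  assume "\<not> ?thesis"
  then obtain u where u: "t < u" "ereal u < lower_box_dim E"
    using ereal_dense2[of "ereal t" "lower_box_dim E"] by (auto simp: not_le)
  have ev: "\<forall>\<^sub>F \<delta> in at_right 0. ereal u < ereal (ln (real (covering_number \<delta> E)) / - ln \<delta>)"
    using u(2) less_LiminfD unfolding lower_box_dim_def by fastforce
  have "\<forall>\<^sub>F \<delta> in at_right 0. u < ln (real (covering_number \<delta> E)) / - ln \<delta> \<and>
      0 < \<delta> \<and> ln \<delta> < min 0 (- ln c / (u - t))"
    using ev eventually_small[of "min 0 (- ln c / (u - t))"] by eventually_elim simp
  from frequently_ex[OF frequently_eventually_conj[OF freq this]]
  obtain \<delta> where \<delta>: "real (covering_number \<delta> E) \<le> c * \<delta> powr (-t)"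
      "u < ln (real (covering_number \<delta> E)) / - ln \<delta>" "0 < \<delta>" "ln \<delta> < 0" "ln \<delta> < - ln c / (u - t)"
    by auto
  have pos: "1 \<le> covering_number \<delta> E" using covering_number_pos assms \<delta>(3) by blast
  have "0 < c * \<delta> powr (-t)" using pos \<delta>(1) by linarith
  then have "0 < c" using \<delta>(3) by (simp add: zero_less_mult_iff)
  have "u * - ln \<delta> < ln (real (covering_number \<delta> E))" using \<delta>(2,4) by (simp add: field_simps)
  also have "\<dots> \<le> ln (c * \<delta> powr (-t))" using \<delta>(1) pos by (intro ln_mono) auto
  also have "\<dots> = ln c + - t * ln \<delta>" using \<open>0 < c\<close> \<delta>(3) by (simp add: ln_mult ln_powr)
  finally have "(u - t) * - ln \<delta> < ln c" by (simp add: algebra_simps)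
  moreover have "ln c < (u - t) * - ln \<delta>" using \<delta>(5) u(1) by (simp add: field_simps)
  ultimately show False by simp
qed

lemma frequently_covering_number_le:
  assumes "compact E" "E \<noteq> {}" "lower_box_dim E < ereal t"
  shows "frequently (\<lambda>\<delta>. real (covering_number \<delta> E) \<le> \<delta> powr (-t)) (at_right 0)"
proof -
  have "\<exists>\<^sub>F \<delta> in at_right 0. \<not> ereal t \<le> ereal (ln (real (covering_number \<delta> E)) / - ln \<delta>)"
    unfolding frequently_def not_not
  proof
    assume "\<forall>\<^sub>F \<delta> in at_right 0. ereal t \<le> ereal (ln (real (covering_number \<delta> E)) / - ln \<delta>)"
    from Liminf_bounded[OF this] show False
      using assms(3) unfolding lower_box_dim_def by simp
  qed
  from frequently_eventually_conj[OF this eventually_small[of 0]]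
  show ?thesis
  proof (rule frequently_elim1)
    fix \<delta> assume \<delta>: "(0 < \<delta> \<and> ln \<delta> < 0) \<and>
      \<not> ereal t \<le> ereal (ln (real (covering_number \<delta> E)) / - ln \<delta>)"
    have pos: "1 \<le> covering_number \<delta> E" using covering_number_pos assms \<delta> by blast
    have "ln (real (covering_number \<delta> E)) \<le> - t * ln \<delta>"
      using \<delta> by (auto simp: not_le field_simps)
    also have "\<dots> = ln (\<delta> powr (-t))" using \<delta> by (simp add: ln_powr)
    finally show "real (covering_number \<delta> E) \<le> \<delta> powr (-t)"
      using pos \<delta> ln_le_cancel_iff[of "real (covering_number \<delta> E)" "\<delta> powr (-t)"]
      by (simp del: ln_powr)
  qed
qed


section \<open>Growth of covering numbers under scaling recursions\<close>

text \<open>An induction that starts with all scales at least \<open>D\<close> and passes to smaller ones. A similarity with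
  ratio at most \<open>R\<close> relates the scale \<open>\<delta>\<close> to a scale at least \<open>\<delta> / R\<close>, so finitely many steps
  lead from any \<open>\<delta>\<close> to the range \<open>\<delta> \<ge> D\<close>.\<close>

lemma scale_induct:
  fixes R D \<delta> :: real
  assumes R: "0 < R" "R < 1" and "0 < D" "0 < \<delta>"
    and base: "\<And>\<delta>. D \<le> \<delta> \<Longrightarrow> P \<delta>"
    and step: "\<And>\<delta>. \<lbrakk>0 < \<delta>; \<delta> < D; \<And>\<epsilon>. \<delta> / R \<le> \<epsilon> \<Longrightarrow> P \<epsilon>\<rbrakk> \<Longrightarrow> P \<delta>"
  shows "P \<delta>"
proof -
  have *: "P \<epsilon>" if "D * R ^ n \<le> \<epsilon>" for n \<epsilon>
    using that
  proof (induction n arbitrary: \<epsilon>)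
    case 0
    then show ?case by (intro base) simp
  next
    case (Suc n)
    have pos: "0 < \<epsilon>" using Suc.prems R(1) \<open>0 < D\<close>
      by (meson less_le_trans mult_pos_pos zero_less_power)
    show ?case
    proof (cases "D \<le> \<epsilon>")
      case False
      show ?thesis
      proof (rule step[OF pos])
        fix \<eta> assume "\<epsilon> / R \<le> \<eta>"
        moreover have "D * R ^ n \<le> \<epsilon> / R" using Suc.prems R(1) by (simp add: field_simps)
        ultimately show "P \<eta>" by (intro Suc.IH) simp
      qed (use False in simp)
    qed (rule base)
  qed
  obtain n where "R ^ n < \<delta> / D"
    using real_arch_pow_inv[of "\<delta> / D" R] R \<open>0 < D\<close> \<open>0 < \<delta>\<close> by auto
  then have "D * R ^ n \<le> \<delta>" using \<open>0 < D\<close> by (simp add: field_simps)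
  then show ?thesis by (rule *)
qed

lemma similarity_ifsD:
  assumes "similarity_ifs X N S r" "i \<in> {1..N}"
  shows "S i ` X \<subseteq> X" "0 < r i" "r i < 1"
    and "\<And>x y. x \<in> X \<Longrightarrow> y \<in> X \<Longrightarrow> dist (S i x) (S i y) = r i * dist x y"
  using assms unfolding similarity_ifs_def by auto

lemma similarity_continuous_on:
  fixes f :: "'a::metric_space \<Rightarrow> 'b::metric_space"
  assumes "0 \<le> \<rho>" "\<And>x y. x \<in> E \<Longrightarrow> y \<in> E \<Longrightarrow> dist (f x) (f y) = \<rho> * dist x y"
  shows "continuous_on E f"
proof -
  have "\<rho>-lipschitz_on E f" using assms by (intro lipschitz_onI) auto
  then show ?thesis by (rule lipschitz_on_continuous_on)
qed

lemma covering_number_inhomogeneous_le: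
  assumes ifs: "similarity_ifs X N S r"
    and G: "compact G" "G \<subseteq> X" "G = (\<Union>i\<in>{1..N}. S i ` G) \<union> C" and C: "compact C"
    and "0 < \<delta>"
  shows "covering_number \<delta> G \<le> (\<Sum>i=1..N. covering_number (\<delta> / r i) G) + covering_number \<delta> C"
proof -
  note D = similarity_ifsD[OF ifs]
  have sim: "dist (S i x) (S i y) = r i * dist x y" if "i \<in> {1..N}" "x \<in> G" "y \<in> G" for i x y
    using D(4)[OF that(1), of x y] that(2,3) G(2) by blast
  have comp: "compact (S i ` G)" if i: "i \<in> {1..N}" for i
    by (intro compact_continuous_image similarity_continuous_on[OF _ sim[OF i]] G(1))
      (use D(2)[OF i] in simp)
  have "covering_number \<delta> G = covering_number \<delta> ((\<Union>i\<in>{1..N}. S i ` G) \<union> C)"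
    using G(3) by simp
  also have "\<dots> \<le> covering_number \<delta> (\<Union>i\<in>{1..N}. S i ` G) + covering_number \<delta> C"
    using comp C \<open>0 < \<delta>\<close> by (intro covering_number_Un compact_UN) auto
  also have "covering_number \<delta> (\<Union>i\<in>{1..N}. S i ` G) \<le> (\<Sum>i=1..N. covering_number \<delta> (S i ` G))"
    using comp \<open>0 < \<delta>\<close> by (intro covering_number_UN) auto
  also have "\<dots> \<le> (\<Sum>i=1..N. covering_number (\<delta> / r i) G)"
  proof (rule sum_mono)
    fix i assume i: "i \<in> {1..N}"
    have "dist (S i x) (S i y) \<le> r i * dist x y" if "x \<in> G" "y \<in> G" for x y
      using sim[OF i that] by simp
    then show "covering_number \<delta> (S i ` G) \<le> covering_number (\<delta> / r i) G"
      using G(1) \<open>0 < \<delta>\<close> D(2)[OF i] by (intro covering_number_image_le)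
  qed
  finally show ?thesis by simp
qed

text \<open>Fix a smallest scale \<open>\<delta>0\<close>. Above it the condensation set contributes at most the constant
  \<open>k = covering_number \<delta>0 C\<close> to each step of the recursion
  $M(\<delta>) \<le> \<Sum>_i M(\<delta> / r_i) + k$ for the covering numbers $M$ of \<open>G\<close>. A multiple of
  $(k + 1) \<delta>^{-t}$ is a supersolution, because \<open>\<Sum>i. r i powr t < 1\<close> leaves room to absorb \<open>k\<close>. The
  constants \<open>b\<close> and \<open>D\<close> are independent of \<open>\<delta>0\<close>, and evaluating the bound at \<open>\<delta>0\<close> itself gives the
  claim.\<close>

lemma covering_number_inhomogeneous_power_bound:
  assumes ifs: "similarity_ifs X N S r"
    and G: "compact G" "G \<subseteq> X" "G = (\<Union>i\<in>{1..N}. S i ` G) \<union> C" and C: "compact C"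
    and q: "(\<Sum>i=1..N. r i powr t) < 1" and "0 \<le> t"
  obtains b D where "0 < b" "0 < D"
    "\<And>\<delta>. 0 < \<delta> \<Longrightarrow> \<delta> \<le> D \<Longrightarrow>
       real (covering_number \<delta> G) \<le> b * (real (covering_number \<delta> C) + 1) * \<delta> powr (-t)"
proof -
  note sim = similarity_ifsD[OF ifs]
  have N: "{1..N} \<noteq> {}" using ifs by (auto simp: similarity_ifs_def)
  \<comment> \<open>Adding \<open>1\<close> keeps \<open>D\<close> positive when \<open>G\<close> is a single point.\<close>
  define D where "D = diameter G + 1"
  define R where "R = Max (r ` {1..N})"
  define \<rho> where "\<rho> = Min (r ` {1..N})"
  define q where "q = (\<Sum>i=1..N. r i powr t)"
  \<comment> \<open>The first term lets the factor \<open>1 - q\<close> absorb the contribution of \<open>C\<close>. The second one makes the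
    bound exceed \<open>1\<close> on the range \<open>D \<le> \<delta> \<le> D / \<rho>\<close> that one step of the recursion can reach.\<close>
  define a where "a = max (1 / (1 - q)) (\<rho> powr (-t))"
  have D: "1 \<le> D" "\<And>\<delta>. D \<le> \<delta> \<Longrightarrow> covering_number \<delta> G \<le> 1"
    using diameter_ge_0[of G] covering_number_le_1[of G] compact_imp_bounded[OF G(1)]
    by (auto simp: D_def)
  have "R \<in> r ` {1..N}" "\<rho> \<in> r ` {1..N}"
    unfolding R_def \<rho>_def using N by (auto intro!: Max_in Min_in simp del: image_eqI)
  then have R: "0 < R" "R < 1" and \<rho>: "0 < \<rho>" using sim(2,3) by blast+
  have r: "r i \<le> R" "\<rho> \<le> r i" if "i \<in> {1..N}" for i
    using that unfolding R_def \<rho>_def by simp_all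
  have \<rho>R: "\<rho> \<le> 1" using r(2) sim(3) N by (meson all_not_in_conv less_imp_le order_trans)
  have q1: "0 < 1 - q" using q by (simp add: q_def)
  have "1 / (1 - q) \<le> a" and "\<rho> powr (-t) \<le> a" by (simp_all add: a_def)
  moreover from this have "0 < a" using q1 by (meson less_le_trans zero_less_divide_1_iff)
  ultimately have a: "0 < a" "1 \<le> a * (1 - q)" "\<rho> powr (-t) \<le> a"
    using q1 by (simp_all add: pos_divide_le_eq)
  have bound: "real (covering_number \<delta> G) \<le> (real k + 1) * a * (D / \<delta>) powr t"
    if k: "k = covering_number \<delta>0 C" and "0 < \<delta>0" "\<delta>0 \<le> \<delta>" "\<delta> \<le> D / \<rho>" for \<delta> \<delta>0 k
  proof -
    have "0 < \<delta>" using that by simp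
    let ?P = "\<lambda>\<delta>. \<delta>0 \<le> \<delta> \<longrightarrow> \<delta> \<le> D / \<rho> \<longrightarrow>
      real (covering_number \<delta> G) \<le> (real k + 1) * a * (D / \<delta>) powr t"
    have "?P \<delta>"
    proof (rule scale_induct[of R D \<delta> ?P, OF R _ \<open>0 < \<delta>\<close>])
      show "0 < D" using D(1) by simp
    next
      fix \<delta> assume "D \<le> \<delta>"
      show "?P \<delta>"
      proof (intro impI)
        assume "\<delta> \<le> D / \<rho>"
        have "0 < \<delta>" using D(1) \<open>D \<le> \<delta>\<close> by simp
        have "\<rho> \<le> D / \<delta>" using \<open>\<delta> \<le> D / \<rho>\<close> \<open>0 < \<delta>\<close> \<rho> by (simp add: field_simps)
        then have "\<rho> powr t \<le> (D / \<delta>) powr t" using \<rho> \<open>0 \<le> t\<close> by (intro powr_mono2) auto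
        then have "\<rho> powr (-t) * \<rho> powr t \<le> a * (D / \<delta>) powr t"
          using a by (intro mult_mono) auto
        then have "1 \<le> a * (D / \<delta>) powr t" using \<rho> by (simp add: powr_minus)
        then have "1 * 1 \<le> (real k + 1) * (a * (D / \<delta>) powr t)" by (intro mult_mono) auto
        moreover have "real (covering_number \<delta> G) \<le> 1" using D(2)[OF \<open>D \<le> \<delta>\<close>] by simp
        ultimately show "real (covering_number \<delta> G) \<le> (real k + 1) * a * (D / \<delta>) powr t"
          by (simp add: mult.assoc)
      qed
    next
      fix \<delta> assume \<delta>: "0 < \<delta>" "\<delta> < D" and IH: "\<And>\<epsilon>. \<delta> / R \<le> \<epsilon> \<Longrightarrow> ?P \<epsilon>"
      show "?P \<delta>"
      proof (intro impI)
        assume "\<delta>0 \<le> \<delta>"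
        let ?Y = "(D / \<delta>) powr t"
        have Y: "1 \<le> ?Y" using \<delta> \<open>0 \<le> t\<close> by (intro ge_one_powr_ge_zero) auto
        have term_le: "real (covering_number (\<delta> / r i) G) \<le> (real k + 1) * a * ?Y * r i powr t"
          if i: "i \<in> {1..N}" for i
        proof -
          have ri: "0 < r i" "r i \<le> R" "\<rho> \<le> r i" "r i \<le> 1" using sim(2,3)[OF i] r[OF i] by auto
          have 1: "\<delta> / R \<le> \<delta> / r i" 
            using ri \<delta>(1) by (intro divide_left_mono) (auto intro: mult_pos_pos R(1) less_imp_le)
          have "\<delta> * r i \<le> \<delta> * 1" using ri(4) \<delta>(1) by (intro mult_left_mono) auto
          then have "\<delta> \<le> \<delta> / r i" using ri(1) by (simp add: pos_le_divide_eq)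
          then have 2: "\<delta>0 \<le> \<delta> / r i" using \<open>\<delta>0 \<le> \<delta>\<close> by simp
          have 3: "\<delta> / r i \<le> D / \<rho>" using ri \<delta> \<rho> D(1) by (intro frac_le) auto
          have "real (covering_number (\<delta> / r i) G) \<le> (real k + 1) * a * (D / (\<delta> / r i)) powr t"
            using IH[OF 1] 2 3 by simp
          also have "D / (\<delta> / r i) = D / \<delta> * r i" by simp
          also have "(D / \<delta> * r i) powr t = ?Y * r i powr t" by (rule powr_mult)
          finally show ?thesis by (simp add: mult.assoc)
        qed
        have "covering_number \<delta> G
            \<le> (\<Sum>i=1..N. covering_number (\<delta> / r i) G) + covering_number \<delta> C"
          using \<delta>(1) by (intro covering_number_inhomogeneous_le[OF ifs G C])
        also have "covering_number \<delta> C \<le> k"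
          unfolding k using C \<open>0 < \<delta>0\<close> \<open>\<delta>0 \<le> \<delta>\<close> by (intro covering_number_mono) auto
        finally have "real (covering_number \<delta> G)
            \<le> real ((\<Sum>i=1..N. covering_number (\<delta> / r i) G) + k)" by (intro of_nat_mono) simp
        also have "\<dots> = (\<Sum>i=1..N. real (covering_number (\<delta> / r i) G)) + real k" by simp
        also have "\<dots> \<le> (\<Sum>i=1..N. (real k + 1) * a * ?Y * r i powr t) + real k"
          using term_le by (intro add_right_mono sum_mono) auto
        also have "\<dots> = (real k + 1) * a * ?Y * q + real k"
          unfolding q_def by (simp add: sum_distrib_left)
        also have "\<dots> \<le> (real k + 1) * a * ?Y"
        proof -
          have "1 * 1 \<le> (a * (1 - q)) * ?Y" using a(2) Y by (intro mult_mono) auto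
          then have "(real k + 1) * 1 \<le> (real k + 1) * ((a * (1 - q)) * ?Y)"
            by (intro mult_left_mono) auto
          then show ?thesis by (simp add: algebra_simps)
        qed
        finally show "real (covering_number \<delta> G) \<le> (real k + 1) * a * ?Y" .
      qed
    qed
    then show ?thesis using that by simp
  qed
  show thesis
  proof (rule that[of "a * D powr t" D])
    show "0 < a * D powr t" "0 < D" using a D by auto
    fix \<delta> assume \<delta>: "0 < \<delta>" "\<delta> \<le> D"
    have "\<delta> \<le> D / \<rho>"
    proof -
      have "D \<le> D / \<rho>" using D(1) \<rho> \<rho>R by (simp add: field_simps)
      then show ?thesis using \<delta>(2) by simp
    qed
    then have "real (covering_number \<delta> G)
        \<le> (real (covering_number \<delta> C) + 1) * a * (D / \<delta>) powr t"
      using bound[of "covering_number \<delta> C" \<delta> \<delta>] \<delta>(1) by simp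
    also have "\<dots> = a * D powr t * (real (covering_number \<delta> C) + 1) * \<delta> powr (-t)"
      using \<delta>(1) D(1) by (simp add: powr_divide powr_minus_divide)
    finally show "real (covering_number \<delta> G)
        \<le> a * D powr t * (real (covering_number \<delta> C) + 1) * \<delta> powr (-t)" .
  qed
qed

text \<open>Since \<open>C\<close> has lower dimension \<open>0\<close>, there are arbitrarily small scales \<open>\<delta>\<close> at which its covering
  number is at most $\<delta>^{-\<epsilon>}$. At those scales the condensation set costs only a factor $\<delta>^{-\<epsilon>}$
  in the power bound, however large the covering numbers of \<open>C\<close> are at other scales.\<close>

lemma lower_box_dim_inhomogeneous_le:
  assumes ifs: "similarity_ifs X N S r"
    and G: "compact G" "G \<subseteq> X" "G \<noteq> {}" "G = (\<Union>i\<in>{1..N}. S i ` G) \<union> C"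
    and C: "compact C" "C \<noteq> {}" "lower_box_dim C \<le> 0"
    and t: "(\<Sum>i=1..N. r i powr t) < 1" "0 \<le> t"
  shows "lower_box_dim G \<le> ereal t"
proof (rule ereal_le_epsilon2)
  fix \<epsilon> :: real assume "0 < \<epsilon>"
  obtain b D where b: "0 < b" "0 < D" "\<And>\<delta>. 0 < \<delta> \<Longrightarrow> \<delta> \<le> D \<Longrightarrow>
       real (covering_number \<delta> G) \<le> b * (real (covering_number \<delta> C) + 1) * \<delta> powr (-t)"
    using covering_number_inhomogeneous_power_bound[OF ifs G(1,2,4) C(1) t] by blast
  have "lower_box_dim C < ereal \<epsilon>"
    using C(3) \<open>0 < \<epsilon>\<close> by (simp add: le_less_trans)
  note freq = frequently_covering_number_le[OF C(1,2) this]
  have ev: "eventually (\<lambda>\<delta>. 0 < \<delta> \<and> ln \<delta> < min 0 (ln D)) (at_right 0)"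
    by (rule eventually_small)
  have "lower_box_dim G \<le> ereal (t + \<epsilon>)"
  proof (rule lower_box_dim_leI[OF G(1,3)], rule frequently_elim1[OF frequently_eventually_conj[OF freq ev]])
    fix \<delta> assume \<delta>: "(0 < \<delta> \<and> ln \<delta> < min 0 (ln D)) \<and> real (covering_number \<delta> C) \<le> \<delta> powr (-\<epsilon>)"
    then have "\<delta> < 1" "\<delta> \<le> D" using b(2) by auto
    have "1 \<le> \<delta> powr (-\<epsilon>)"
      using powr_mono'[of "-\<epsilon>" 0 \<delta>] \<delta> \<open>\<delta> < 1\<close> \<open>0 < \<epsilon>\<close> by simp
    then have "b * (real (covering_number \<delta> C) + 1) * \<delta> powr (-t)
        \<le> b * (2 * \<delta> powr (-\<epsilon>)) * \<delta> powr (-t)"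
      using \<delta> b(1) by (intro mult_right_mono mult_left_mono) auto
    then have "real (covering_number \<delta> G) \<le> b * (2 * \<delta> powr (-\<epsilon>)) * \<delta> powr (-t)"
      using b(3)[of \<delta>] \<delta> \<open>\<delta> \<le> D\<close> by simp
    also have "\<dots> = (2 * b) * \<delta> powr (- (t + \<epsilon>))" by (simp add: powr_add[symmetric] add.commute)
    finally show "real (covering_number \<delta> G) \<le> (2 * b) * \<delta> powr (- (t + \<epsilon>))" .
  qed
  then show "lower_box_dim G \<le> ereal t + ereal \<epsilon>" by simp
qed

lemma compact_disjoint_family_separated:
  fixes K :: "'b \<Rightarrow> 'a::metric_space set"
  assumes "finite J" "\<And>j. j \<in> J \<Longrightarrow> compact (K j)" "disjoint_family_on K J"
  obtains d where "0 < d"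
    "\<And>i j x y. \<lbrakk>i \<in> J; j \<in> J; i \<noteq> j; x \<in> K i; y \<in> K j\<rbrakk> \<Longrightarrow> d \<le> dist x y"
proof -
  define Q where "Q = {(i, j). i \<in> J \<and> j \<in> J \<and> i \<noteq> j}"
  have "\<exists>d>0. \<forall>x\<in>K (fst p). \<forall>y\<in>K (snd p). d \<le> dist x y" if "p \<in> Q" for p
  proof (cases "K (fst p) = {} \<or> K (snd p) = {}")
    case True
    then show ?thesis by (intro exI[of _ 1]) auto
  next
    case False
    have K: "compact (K (fst p))" "closed (K (snd p))" "K (fst p) \<inter> K (snd p) = {}"
      using that assms(2) disjoint_family_onD[OF assms(3)]
      by (auto simp: Q_def intro: compact_imp_closed) blast
    have cont: "continuous_on (K (fst p)) (\<lambda>x. infdist x (K (snd p)))"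
      by (intro continuous_on_infdist continuous_on_id)
    obtain z where z: "z \<in> K (fst p)"
        "\<And>x. x \<in> K (fst p) \<Longrightarrow> infdist z (K (snd p)) \<le> infdist x (K (snd p))"
      using continuous_attains_inf[OF K(1) _ cont] False by blast
    have "0 < infdist z (K (snd p))"
      using z(1) K(2,3) False by (intro infdist_pos_not_in_closed) auto
    moreover have "infdist z (K (snd p)) \<le> dist x y" if "x \<in> K (fst p)" "y \<in> K (snd p)" for x y
      using z(2)[OF that(1)] infdist_le[OF that(2), of x] by simp
    ultimately show ?thesis by blast
  qed
  then obtain f where f: "\<And>p. p \<in> Q \<Longrightarrow> 0 < f p"
      "\<And>p x y. p \<in> Q \<Longrightarrow> x \<in> K (fst p) \<Longrightarrow> y \<in> K (snd p) \<Longrightarrow> f p \<le> dist x y"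
    by metis
  have "finite Q" by (rule finite_subset[of _ "J \<times> J"]) (use assms(1) in \<open>auto simp: Q_def\<close>)
  show thesis
  proof (rule that[of "Min (insert 1 (f ` Q))"])
    show "0 < Min (insert 1 (f ` Q))" using \<open>finite Q\<close> f(1) by auto
    fix i j x y assume *: "i \<in> J" "j \<in> J" "i \<noteq> j" "x \<in> K i" "y \<in> K j"
    then have "(i, j) \<in> Q" by (simp add: Q_def)
    then have "Min (insert 1 (f ` Q)) \<le> f (i, j)" using \<open>finite Q\<close> by (intro Min_le) auto
    also have "\<dots> \<le> dist x y" using f(2)[OF \<open>(i, j) \<in> Q\<close>] * by simp
    finally show "Min (insert 1 (f ` Q)) \<le> dist x y" .
  qed
qed

text \<open>Disjoint compact copies of \<open>K\<close> inside \<open>K\<close> have a positive distance \<open>d\<close>. Below the scale \<open>d\<close> the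
  covering numbers $M$ of \<open>K\<close> therefore satisfy $M(\<delta>) \<ge> \<Sum>_j M(\<delta> / \<rho>_j)$, and
  $(d / \<delta>)^t$ is a subsolution of this recursion because \<open>\<Sum>j. \<rho> j powr t \<ge> 1\<close>.\<close>

lemma lower_box_dim_ge_disjoint_copies:
  fixes K :: "'a::metric_space set" and T :: "'b \<Rightarrow> 'a \<Rightarrow> 'a"
  assumes K: "compact K" "K \<noteq> {}" and "finite J"
    and T: "\<And>j. j \<in> J \<Longrightarrow> T j ` K \<subseteq> K" "disjoint_family_on (\<lambda>j. T j ` K) J"
    and \<rho>: "\<And>j. j \<in> J \<Longrightarrow> 0 < \<rho> j" "\<And>j. j \<in> J \<Longrightarrow> \<rho> j < 1"
    and sim: "\<And>j x y. j \<in> J \<Longrightarrow> x \<in> K \<Longrightarrow> y \<in> K \<Longrightarrow> dist (T j x) (T j y) = \<rho> j * dist x y"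
    and t: "0 \<le> t" "1 \<le> (\<Sum>j\<in>J. \<rho> j powr t)"
  shows "ereal t \<le> lower_box_dim K"
proof -
  have "J \<noteq> {}" using t(2) by auto
  have comp: "compact (T j ` K)" if "j \<in> J" for j
    using K(1) \<rho>(1)[OF that] sim[OF that]
    by (intro compact_continuous_image similarity_continuous_on[of "\<rho> j"]) auto
  obtain d where d: "0 < d"
    "\<And>i j x y. \<lbrakk>i \<in> J; j \<in> J; i \<noteq> j; x \<in> T i ` K; y \<in> T j ` K\<rbrakk> \<Longrightarrow> d \<le> dist x y"
    using compact_disjoint_family_separated[OF \<open>finite J\<close> comp T(2)] by blast
  define R where "R = Max (\<rho> ` J)"
  have "R \<in> \<rho> ` J" unfolding R_def using \<open>finite J\<close> \<open>J \<noteq> {}\<close> by (intro Max_in) auto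
  then have R: "0 < R" "R < 1" "\<And>j. j \<in> J \<Longrightarrow> \<rho> j \<le> R"
    using \<rho> \<open>finite J\<close> by (auto simp: R_def)
  have bound: "(d / \<delta>) powr t \<le> real (covering_number \<delta> K)" if "0 < \<delta>" for \<delta>
    using R(1,2) d(1) that
  proof (rule scale_induct)
    fix \<delta> assume "d \<le> \<delta>"
    then have "(d / \<delta>) powr t \<le> 1" using d(1) t(1) by (intro powr_le1) auto
    moreover have "1 \<le> covering_number \<delta> K"
      using covering_number_pos[OF K] d(1) \<open>d \<le> \<delta>\<close> by simp
    ultimately show "(d / \<delta>) powr t \<le> real (covering_number \<delta> K)" by linarith
  next
    fix \<delta> assume \<delta>: "0 < \<delta>" "\<delta> < d"
      and IH: "\<And>\<epsilon>. \<delta> / R \<le> \<epsilon> \<Longrightarrow> (d / \<epsilon>) powr t \<le> real (covering_number \<epsilon> K)"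
    have "(d / \<delta>) powr t * 1 \<le> (d / \<delta>) powr t * (\<Sum>j\<in>J. \<rho> j powr t)"
      using t(2) by (intro mult_left_mono) auto
    also have "\<dots> = (\<Sum>j\<in>J. (d / \<delta> * \<rho> j) powr t)"
      unfolding sum_distrib_left by (intro sum.cong refl powr_mult[symmetric])
    also have "\<dots> \<le> (\<Sum>j\<in>J. real (covering_number \<delta> (T j ` K)))"
    proof (rule sum_mono)
      fix j assume j: "j \<in> J"
      have "\<delta> / R \<le> \<delta> / \<rho> j" using R(1,3) \<rho>(1) j \<delta>(1) by (intro divide_left_mono) auto
      from IH[OF this] have "(d / \<delta> * \<rho> j) powr t \<le> real (covering_number (\<delta> / \<rho> j) K)" by simp
      also have "covering_number (\<delta> / \<rho> j) K \<le> covering_number \<delta> (T j ` K)"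
        by (rule covering_number_image_ge[OF comp[OF j] \<delta>(1) \<rho>(1)[OF j]]) (simp add: sim[OF j])
      finally show "(d / \<delta> * \<rho> j) powr t \<le> real (covering_number \<delta> (T j ` K))" by simp
    qed
    also have "\<dots> = real (\<Sum>j\<in>J. covering_number \<delta> (T j ` K))" by simp
    also have "(\<Sum>j\<in>J. covering_number \<delta> (T j ` K)) \<le> covering_number \<delta> K"
      using K(1) \<open>finite J\<close> \<delta> T(1) d(2) by (rule covering_number_separated)
    finally show "(d / \<delta>) powr t \<le> real (covering_number \<delta> K)" by simp
  qed
  show ?thesis
  proof (rule lower_box_dim_geI[of "d powr t"])
    show "0 < d powr t" using d(1) by simp
    show "d powr t * \<delta> powr (-t) \<le> real (covering_number \<delta> K)" if "0 < \<delta>" for \<delta>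
      using bound[OF that] d(1) that by (simp add: powr_divide powr_minus_divide)
  qed
qed


section \<open>Words over the alphabet of an iterated function system\<close>

definition words :: "nat \<Rightarrow> nat \<Rightarrow> nat list set" where
  "words N m = {w. set w \<subseteq> {1..N} \<and> length w = m}"

definition word_map :: "(nat \<Rightarrow> 'a \<Rightarrow> 'a) \<Rightarrow> nat list \<Rightarrow> 'a \<Rightarrow> 'a" where
  "word_map S w = foldr S w"

definition word_ratio :: "(nat \<Rightarrow> real) \<Rightarrow> nat list \<Rightarrow> real" where
  "word_ratio r w = prod_list (map r w)"

lemma word_map_simps [simp]:
  "word_map S [] x = x" "word_map S (i # w) x = S i (word_map S w x)"
  "word_map S (v @ w) x = word_map S v (word_map S w x)"
  by (simp_all add: word_map_def)

lemma word_ratio_simps [simp]: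
  "word_ratio r [] = 1" "word_ratio r (i # w) = r i * word_ratio r w"
  "word_ratio r (v @ w) = word_ratio r v * word_ratio r w"
  by (simp_all add: word_ratio_def)

lemma word_ratio_pos:
  assumes "\<And>i. i \<in> {1..N} \<Longrightarrow> 0 < r i" "set w \<subseteq> {1..N}"
  shows "0 < word_ratio r w"
  using assms(2) by (induction w) (use assms(1) in auto)

lemma finite_words: "finite (words N m)"
  unfolding words_def by (rule finite_lists_length_eq) simp

lemma words_0: "words N 0 = {[]}"
  by (auto simp: words_def)

lemma words_Suc: "words N (Suc m) = (\<lambda>(w, i). i # w) ` (words N m \<times> {1..N})"
  unfolding words_def by (rule lists_length_Suc_eq)

lemma sum_word_ratio_powr:
  assumes "\<And>i. i \<in> {1..N} \<Longrightarrow> 0 < r i"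
  shows "(\<Sum>w\<in>words N m. word_ratio r w powr t) = (\<Sum>i=1..N. r i powr t) ^ m"
proof (induction m)
  case 0
  then show ?case by (simp add: words_0)
next
  case (Suc m)
  have pos: "0 < word_ratio r w" if "w \<in> words N m" for w
    using that assms word_ratio_pos[of N r w] by (simp add: words_def)
  have "(\<Sum>w\<in>words N (Suc m). word_ratio r w powr t)
      = (\<Sum>(w, i)\<in>words N m \<times> {1..N}. (r i * word_ratio r w) powr t)"
    unfolding words_Suc by (subst sum.reindex) (auto simp: inj_on_def case_prod_unfold)
  also have "\<dots> = (\<Sum>(w, i)\<in>words N m \<times> {1..N}. word_ratio r w powr t * r i powr t)"
    using assms pos by (intro sum.cong) (auto simp: powr_mult less_imp_le)
  also have "\<dots> = (\<Sum>w\<in>words N m. word_ratio r w powr t) * (\<Sum>i=1..N. r i powr t)"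
    by (simp add: sum.cartesian_product sum_product)
  finally show ?case using Suc by (simp add: mult.commute)
qed

lemma word_similarity:
  assumes ifs: "similarity_ifs X N S r" and w: "set w \<subseteq> {1..N}"
  shows "word_map S w ` X \<subseteq> X"
    and "0 < word_ratio r w"
    and "x \<in> X \<Longrightarrow> y \<in> X \<Longrightarrow>
           dist (word_map S w x) (word_map S w y) = word_ratio r w * dist x y"
proof -
  have "word_map S w ` X \<subseteq> X \<and> 0 < word_ratio r w \<and>
      (\<forall>x\<in>X. \<forall>y\<in>X. dist (word_map S w x) (word_map S w y) = word_ratio r w * dist x y)"
    using w
  proof (induction w)
    case (Cons i w)
    then have i: "i \<in> {1..N}" and IH: "word_map S w ` X \<subseteq> X" "0 < word_ratio r w"
        "\<And>x y. x \<in> X \<Longrightarrow> y \<in> X \<Longrightarrow>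
          dist (word_map S w x) (word_map S w y) = word_ratio r w * dist x y"
      by auto
    note D = similarity_ifsD[OF ifs i]
    show ?case
    proof (intro conjI ballI)
      show "word_map S (i # w) ` X \<subseteq> X" using IH(1) D(1) by auto
      show "0 < word_ratio r (i # w)" using IH(2) D(2) by simp
      fix x y assume "x \<in> X" "y \<in> X"
      moreover from this have "word_map S w x \<in> X" "word_map S w y \<in> X" using IH(1) by auto
      ultimately show "dist (word_map S (i # w) x) (word_map S (i # w) y)
          = word_ratio r (i # w) * dist x y"
        using D(4) IH(3) by simp
    qed
  qed auto
  then show "word_map S w ` X \<subseteq> X" "0 < word_ratio r w"
    "x \<in> X \<Longrightarrow> y \<in> X \<Longrightarrow>
      dist (word_map S w x) (word_map S w y) = word_ratio r w * dist x y"
    by auto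
qed

lemma word_ratio_le_power:
  assumes "\<And>i. i \<in> {1..N} \<Longrightarrow> 0 < r i" "\<And>i. i \<in> {1..N} \<Longrightarrow> r i \<le> R" "set w \<subseteq> {1..N}"
  shows "word_ratio r w \<le> R ^ length w"
  using assms(3)
proof (induction w)
  case (Cons i w)
  have "0 \<le> word_ratio r w"
    using Cons.prems assms(1) word_ratio_pos[of N r w] by simp
  moreover have "0 < r i" "r i \<le> R" using Cons.prems assms(1,2)[of i] by auto
  ultimately show ?case using Cons by (auto intro!: mult_mono)
qed simp

lemma word_map_subset:
  assumes "(\<Union>i\<in>{1..N}. S i ` U) \<subseteq> U" "set w \<subseteq> {1..N}"
  shows "word_map S w ` U \<subseteq> U"
  using assms(2)
proof (induction w)
  case (Cons i w)
  then have "word_map S w ` U \<subseteq> U" "S i ` U \<subseteq> U" using assms(1) by (simp_all add: UN_subset_iff)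
  then show ?case by auto
qed simp

lemma attractor_subset_words:
  assumes "F = (\<Union>i\<in>{1..N}. S i ` F)" "x \<in> F"
  shows "\<exists>w\<in>words N m. x \<in> word_map S w ` F"
  using assms(2)
proof (induction m arbitrary: x)
  case 0
  then show ?case by (simp add: words_0)
next
  case (Suc m)
  obtain i y where i: "i \<in> {1..N}" "y \<in> F" "x = S i y" using assms(1) Suc.prems by blast
  obtain w z where w: "w \<in> words N m" "z \<in> F" "y = word_map S w z" using Suc.IH[OF i(2)] by blast
  have "i # w \<in> words N (Suc m)" using i(1) w(1) by (simp add: words_def)
  moreover have "x = word_map S (i # w) z" using i(3) w(3) by simp
  ultimately show ?case using w(2) by blast
qed

text \<open>Two words with different first letters are separated by the open set condition. A common first
  letter can be cancelled since similarities are injective.\<close>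

lemma disjoint_word_images:
  assumes ifs: "similarity_ifs X N S r" and "U \<subseteq> X"
    and inv: "(\<Union>i\<in>{1..N}. S i ` U) \<subseteq> U" and disj: "disjoint_family_on (\<lambda>i. S i ` U) {1..N}"
  shows "disjoint_family_on (\<lambda>w. word_map S w ` U) (words N m)"
proof (induction m)
  case 0
  then show ?case by (simp add: words_0 disjoint_family_on_def)
next
  case (Suc m)
  have "v = w" if vw: "v \<in> words N (Suc m)" "w \<in> words N (Suc m)"
    and x: "x \<in> word_map S v ` U" "x \<in> word_map S w ` U" for v w x
  proof -
    obtain i v' j w' where eq: "v = i # v'" "w = j # w'"
      and ij: "i \<in> {1..N}" "j \<in> {1..N}" and v': "v' \<in> words N m" "w' \<in> words N m"
      using vw unfolding words_Suc by auto
    obtain y z where yz: "y \<in> U" "z \<in> U" "x = S i (word_map S v' y)" "x = S j (word_map S w' z)"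
      using x unfolding eq by auto
    have U: "word_map S v' y \<in> U" "word_map S w' z \<in> U"
      using word_map_subset[OF inv, of v'] word_map_subset[OF inv, of w'] v' yz(1,2)
      by (auto simp: words_def)
    then have "x \<in> S i ` U \<inter> S j ` U" using yz(3,4) by blast
    then have "i = j" using disj ij unfolding disjoint_family_on_def by blast
    have "r i * dist (word_map S v' y) (word_map S w' z) = dist x x"
      using similarity_ifsD(4)[OF ifs ij(1)] U \<open>U \<subseteq> X\<close> yz(3,4) \<open>i = j\<close> by (metis subsetD)
    then have "word_map S v' y = word_map S w' z"
      using similarity_ifsD(2)[OF ifs ij(1)] by simp
    then have "word_map S v' ` U \<inter> word_map S w' ` U \<noteq> {}" using yz(1,2) by blast
    then have "v' = w'" using Suc v' unfolding disjoint_family_on_def by blast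
    then show ?thesis using eq \<open>i = j\<close> by simp
  qed
  then show ?case unfolding disjoint_family_on_def by blast
qed

text \<open>A point of the attractor lies in images of \<open>F\<close> under words with arbitrarily small diameter, and
  such an image is contained in the open set once its diameter is below the distance from the point
  to the complement of \<open>U\<close> in \<open>X\<close>. This is where the strong form of the open set condition enters.\<close>

lemma word_image_in_open_set:
  assumes ifs: "similarity_ifs X N S r"
    and F: "compact F" "F \<subseteq> X" "F = (\<Union>i\<in>{1..N}. S i ` F)"
    and U: "openin (top_of_set X) U" "x \<in> F" "x \<in> U"
  obtains w where "set w \<subseteq> {1..N}" "word_map S w ` F \<subseteq> U"
proof -
  note sim = similarity_ifsD[OF ifs]
  have N: "{1..N} \<noteq> {}" using ifs by (auto simp: similarity_ifs_def)
  obtain e where e: "0 < e" "ball x e \<inter> X \<subseteq> U"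
    using U(1,3) unfolding openin_contains_ball by blast
  define R where "R = Max (r ` {1..N})"
  have "R \<in> r ` {1..N}" unfolding R_def using N by (intro Max_in) auto
  then have R: "0 < R" "R < 1" using sim(2,3) by blast+
  have rR: "r i \<le> R" if "i \<in> {1..N}" for i using that unfolding R_def by simp
  define D where "D = diameter F + 1"
  have D: "0 < D" "\<And>y z. y \<in> F \<Longrightarrow> z \<in> F \<Longrightarrow> dist y z \<le> D"
    using diameter_ge_0[of F] diameter_bounded_bound[of F] compact_imp_bounded[OF F(1)]
    by (auto simp: D_def add_increasing2)
  obtain m where "R ^ m < e / D"
    using real_arch_pow_inv[of "e / D" R] R e(1) D(1) by auto
  then have m: "R ^ m * D < e" using D(1) by (simp add: field_simps)
  obtain w y where w: "w \<in> words N m" "y \<in> F" "x = word_map S w y"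
    using attractor_subset_words[OF F(3) U(2), of m] by blast
  have set_w: "set w \<subseteq> {1..N}" "length w = m" using w(1) by (auto simp: words_def)
  have "word_map S w z \<in> U" if "z \<in> F" for z
  proof -
    have X: "y \<in> X" "z \<in> X" using w(2) that F(2) by auto
    have "dist x (word_map S w z) = word_ratio r w * dist y z"
      unfolding w(3) by (rule word_similarity(3)[OF ifs set_w(1) X])
    also have "\<dots> \<le> R ^ m * D"
      using word_ratio_le_power[OF sim(2) rR set_w(1)] set_w(2) D w(2) that R(1)
      by (intro mult_mono) auto
    finally have "dist x (word_map S w z) < e" using m by simp
    moreover have "word_map S w z \<in> X" using word_similarity(1)[OF ifs set_w(1)] X(2) by blast
    ultimately show ?thesis using e(2) by auto
  qed
  then show thesis using that[of w] set_w(1) by blast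
qed

text \<open>Call the image of \<open>F\<close> under a word its cylinder, and let the cylinder of \<open>w\<close> lie in \<open>U\<close>. For words \<open>v\<close> of a fixed length \<open>m\<close> the
  cylinders of \<open>v @ w\<close> lie in the disjoint images of \<open>U\<close> under \<open>v\<close>, so they are disjoint compact
  copies of \<open>F\<close>. The powers of their ratios add up to $c q^m$, where $c$ is the power of the ratio of
  \<open>w\<close> and $q = \<Sum>_i r_i^t > 1$. A large \<open>m\<close> compensates for the loss \<open>c\<close> caused by the fixed suffix.
  Without the suffix the copies need not be disjoint, since the images of \<open>F\<close> under the words \<open>v\<close> may
  touch.\<close>

lemma lower_box_dim_ge_strong_open_set:
  assumes ifs: "similarity_ifs X N S r"
    and F: "compact F" "F \<noteq> {}" "F \<subseteq> X" "F = (\<Union>i\<in>{1..N}. S i ` F)"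
    and U: "openin (top_of_set X) U" "F \<inter> U \<noteq> {}" "(\<Union>i\<in>{1..N}. S i ` U) \<subseteq> U"
      "disjoint_family_on (\<lambda>i. S i ` U) {1..N}"
    and t: "0 \<le> t" "1 < (\<Sum>i=1..N. r i powr t)"
  shows "ereal t \<le> lower_box_dim F"
proof -
  note sim = similarity_ifsD[OF ifs]
  have "U \<subseteq> X" using U(1) openin_imp_subset by blast
  obtain w where w: "set w \<subseteq> {1..N}" "word_map S w ` F \<subseteq> U"
    using word_image_in_open_set[OF ifs F(1,3,4) U(1)] U(2) by blast
  define q where "q = (\<Sum>i=1..N. r i powr t)"
  define c where "c = word_ratio r w powr t"
  have c: "0 < c" unfolding c_def using word_similarity(2)[OF ifs w(1)] by simp
  obtain m0 where m0: "1 / c < q ^ m0" using real_arch_pow t(2) unfolding q_def by blast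
  \<comment> \<open>The successor makes \<open>v @ w\<close> nonempty, so that its ratio is less than \<open>1\<close>.\<close>
  define m where "m = Suc m0"
  have "1 / c < q ^ m"
    using m0 t(2) power_increasing[of m0 m q] unfolding q_def[symmetric] m_def by linarith
  then have m: "1 \<le> c * q ^ m" using c by (simp add: field_simps)
  have vw: "set (v @ w) \<subseteq> {1..N}" if "v \<in> words N m" for v using that w(1) by (auto simp: words_def)
  have inF: "word_map S v ` F \<subseteq> F" if "set v \<subseteq> {1..N}" for v
    by (rule word_map_subset[OF _ that]) (use F(4) in blast)
  show ?thesis
  proof (rule lower_box_dim_ge_disjoint_copies
      [where J = "words N m" and T = "\<lambda>v. word_map S (v @ w)" and \<rho> = "\<lambda>v. word_ratio r (v @ w)"])
    show "finite (words N m)" by (rule finite_words)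
    show "word_map S (v @ w) ` F \<subseteq> F" if "v \<in> words N m" for v by (rule inF[OF vw[OF that]])
    have sub: "word_map S (v @ w) ` F \<subseteq> word_map S v ` U" for v using w(2) by auto
    show "disjoint_family_on (\<lambda>v. word_map S (v @ w) ` F) (words N m)"
      unfolding disjoint_family_on_def
    proof (intro ballI impI)
      fix u v assume "u \<in> words N m" "v \<in> words N m" "u \<noteq> v"
      then have "word_map S u ` U \<inter> word_map S v ` U = {}"
        using disjoint_family_onD[OF disjoint_word_images[OF ifs \<open>U \<subseteq> X\<close> U(3,4)]] by metis
      then show "word_map S (u @ w) ` F \<inter> word_map S (v @ w) ` F = {}"
        using sub[of u] sub[of v] by blast
    qed
    show "0 < word_ratio r (v @ w)" if "v \<in> words N m" for v
      by (rule word_similarity(2)[OF ifs vw[OF that]])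
    show "word_ratio r (v @ w) < 1" if v: "v \<in> words N m" for v
    proof -
      obtain i u where eq: "v @ w = i # u" and i: "i \<in> {1..N}" "set u \<subseteq> {1..N}"
        using vw[OF v] v by (cases v) (auto simp: words_def m_def)
      have "word_ratio r u \<le> 1 ^ length u"
        using sim(2,3) by (intro word_ratio_le_power[OF _ _ i(2)]) (auto intro: less_imp_le)
      then have "r i * word_ratio r u \<le> r i * 1" using sim(2)[OF i(1)] by (intro mult_left_mono) auto
      then show ?thesis unfolding eq using sim(3)[OF i(1)] by simp
    qed
    show "dist (word_map S (v @ w) x) (word_map S (v @ w) y) = word_ratio r (v @ w) * dist x y"
      if "v \<in> words N m" "x \<in> F" "y \<in> F" for v x y
      using word_similarity(3)[OF ifs vw[OF that(1)]] that(2,3) F(3) by blast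
    have "(\<Sum>v\<in>words N m. word_ratio r (v @ w) powr t) = (\<Sum>v\<in>words N m. word_ratio r v powr t) * c"
      unfolding c_def sum_distrib_right
    proof (rule sum.cong)
      fix v assume "v \<in> words N m"
      then have "0 < word_ratio r v"
        using word_similarity(2)[OF ifs] by (auto simp: words_def)
      then show "word_ratio r (v @ w) powr t = word_ratio r v powr t * word_ratio r w powr t"
        using word_similarity(2)[OF ifs w(1)] by (simp add: powr_mult)
    qed simp
    also have "\<dots> = q ^ m * c" unfolding q_def 
      using sum_word_ratio_powr[of N r t m, OF sim(2)] by simp
    finally show "1 \<le> (\<Sum>v\<in>words N m. word_ratio r (v @ w) powr t)" using m by (simp add: mult.commute)
  qed (use F t in auto)
qed


section \<open>The dimension of the attractors\<close>

lemma similarity_dim_properties: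
  assumes ifs: "similarity_ifs X N S r"
  shows "0 \<le> similarity_dim N r"
    and "similarity_dim N r < t \<Longrightarrow> (\<Sum>i=1..N. r i powr t) < 1"
    and "t < similarity_dim N r \<Longrightarrow> 1 < (\<Sum>i=1..N. r i powr t)"
proof -
  note sim = similarity_ifsD[OF ifs]
  have N: "1 \<le> N" using ifs by (simp add: similarity_ifs_def)
  let ?s = "similarity_dim N r"
  have s: "(\<Sum>i=1..N. r i powr ?s) = 1"
    unfolding similarity_dim_def by (rule theI') (use similarity_dim_ex1[OF N] sim(2,3) in blast)
  have dec: "(\<Sum>i=1..N. r i powr v) < (\<Sum>i=1..N. r i powr u)" if "u < v" for u v
    using that sim(2,3) N by (intro sum_strict_mono) (auto intro!: powr_less_mono')
  show "?s < t \<Longrightarrow> (\<Sum>i=1..N. r i powr t) < 1" and "t < ?s \<Longrightarrow> 1 < (\<Sum>i=1..N. r i powr t)"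
    using dec[of ?s t] dec[of t ?s] s by auto
  show "0 \<le> ?s"
  proof (rule ccontr)
    assume "\<not> 0 \<le> ?s"
    then have "(\<Sum>i=1..N. r i powr 0) < 1" using dec[of ?s 0] s by simp
    moreover have "(\<Sum>i=1..N. r i powr 0) = (\<Sum>i=1..N. 1)"
      using sim(2) by (intro sum.cong refl) (simp add: less_imp_neq[symmetric])
    ultimately show False using N by simp
  qed
qed

lemma inhomogeneous_attractor_properties:
  assumes "compact X" "X \<noteq> {}" "similarity_ifs X N S r" "compact C" "C \<subseteq> X"
  defines "F \<equiv> inhomogeneous_attractor X N S C"
  shows "F \<subseteq> X" "F \<noteq> {}" "compact F" "F = (\<Union>i\<in>{1..N}. S i ` F) \<union> C"
proof -
  have "F \<subseteq> X \<and> F \<noteq> {} \<and> compact F \<and> F = (\<Union>i\<in>{1..N}. S i ` F) \<union> C"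
    unfolding F_def inhomogeneous_attractor_def by (rule theI') (rule attractor_ex1[OF assms(1-5)])
  then show "F \<subseteq> X" "F \<noteq> {}" "compact F" "F = (\<Union>i\<in>{1..N}. S i ` F) \<union> C" by blast+
qed

text \<open>The system restricts to the forward invariant set \<open>G\<close> and has an attractor inside it, which is \<open>F\<close>
  by uniqueness.\<close>

lemma homogeneous_subset_forward_invariant:
  assumes ifs: "similarity_ifs X N S r"
    and F: "F \<subseteq> X" "F \<noteq> {}" "compact F" "F = (\<Union>i\<in>{1..N}. S i ` F)"
    and G: "G \<subseteq> X" "G \<noteq> {}" "compact G" "(\<Union>i\<in>{1..N}. S i ` G) \<subseteq> G"
  shows "F \<subseteq> G"
proof -
  have "similarity_ifs G N S r"
    using ifs G(1,4) unfolding similarity_ifs_def by blast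
  then obtain H where H: "H \<subseteq> G" "H \<noteq> {}" "compact H" "H = (\<Union>i\<in>{1..N}. S i ` H) \<union> {}"
    using attractor_ex1[OF G(3,2), of N S r "{}"] by auto
  have "F \<subseteq> H"
    using attractor_subset[OF ifs F(1,3) _ _ H(2,3,4)] F(4) H(1) G(1) by auto
  then show ?thesis using H(1) by blast
qed

theorem corollary2p9:
  fixes X C :: "'a::metric_space set"
    and N :: nat and S :: "nat \<Rightarrow> 'a \<Rightarrow> 'a" and r :: "nat \<Rightarrow> real"
  assumes "compact X"
    and "similarity_ifs X N S r"
    and "C \<subseteq> X" and "C \<noteq> {}" and "compact C"
    and "max (ereal (similarity_dim N r)) (lower_box_dim C) < upper_box_dim C"
    and "lower_box_dim C = 0"
    and "strong_open_set_condition X N S"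
  shows "lower_box_dim (inhomogeneous_attractor X N S C) =
           max (lower_box_dim (homogeneous_attractor X N S)) (lower_box_dim C) \<and>
         max (lower_box_dim (homogeneous_attractor X N S)) (lower_box_dim C) =
           lower_box_dim (homogeneous_attractor X N S) \<and>
         lower_box_dim (homogeneous_attractor X N S) = ereal (similarity_dim N r)"
proof -
  note ifs = assms(2)
  define F where "F = homogeneous_attractor X N S"
  define G where "G = inhomogeneous_attractor X N S C"
  define s where "s = similarity_dim N r"
  have "X \<noteq> {}" using assms(3,4) by blast
  note s = similarity_dim_properties[OF ifs, folded s_def]
  have F: "F \<subseteq> X" "F \<noteq> {}" "compact F" "F = (\<Union>i\<in>{1..N}. S i ` F)"
    using inhomogeneous_attractor_properties[OF assms(1) \<open>X \<noteq> {}\<close> ifs, of "{}"]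
    unfolding F_def homogeneous_attractor_eq by simp_all
  note G = inhomogeneous_attractor_properties[OF assms(1) \<open>X \<noteq> {}\<close> ifs assms(5,3), folded G_def]
  have "F \<subseteq> G"
    using G by (intro homogeneous_subset_forward_invariant[OF ifs F]) auto
  have "ereal s \<le> lower_box_dim F"
  proof (rule dense_le)
    fix y assume "y < ereal s"
    then obtain t where t: "y < ereal t" "t < s" using ereal_dense2[of y "ereal s"] by auto
    obtain U where U: "openin (top_of_set X) U" "F \<inter> U \<noteq> {}" "(\<Union>i\<in>{1..N}. S i ` U) \<subseteq> U"
        "disjoint_family_on (\<lambda>i. S i ` U) {1..N}"
      using assms(8) unfolding strong_open_set_condition_def F_def by blast
    \<comment> \<open>The disjoint copies only bound the dimension from below by nonnegative exponents. When \<open>s = 0\<close>,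
      as for a single map, no such exponent is less than \<open>s\<close>.\<close>
    have "ereal t \<le> lower_box_dim F"
    proof (cases "0 \<le> t")
      case True
      then show ?thesis
        using lower_box_dim_ge_strong_open_set[OF ifs F(3,2,1,4) U] s(3)[OF t(2)] by blast
    next
      case False
      then have "ereal t \<le> 0" by simp
      then show ?thesis using lower_box_dim_nonneg[OF F(3,2)] by (rule order_trans)
    qed
    then show "y \<le> lower_box_dim F" using t(1) by simp
  qed
  moreover have "lower_box_dim F \<le> lower_box_dim G"
    by (rule lower_box_dim_mono[OF \<open>F \<subseteq> G\<close> F(2,3) G(3)])
  moreover have "lower_box_dim G \<le> ereal s"
  proof (rule dense_ge)
    fix y assume "ereal s < y"
    then obtain t where t: "s < t" "ereal t < y" using ereal_dense2[of "ereal s" y] by auto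
    have "lower_box_dim G \<le> ereal t"
      using assms(7) s(1) t(1)
      by (intro lower_box_dim_inhomogeneous_le[OF ifs G(3,1,2,4) assms(5,4) _ s(2)]) auto
    then show "lower_box_dim G \<le> y" using t(2) by simp
  qed
  ultimately have "lower_box_dim F = ereal s" "lower_box_dim G = ereal s" by auto
  then show ?thesis
    using s(1) assms(7) unfolding F_def G_def s_def by (simp add: max_def)
qed

end
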